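(* Let $c\in[0,\frac12]$. (i) If $x\in[c,1]\setminus\mathbb{Q}$, then no generalised Lüroth expansion of $x$ produced by $L_c$ is ultimately periodic. (ii) If $x\in[c,1]\cap\mathbb{Q}$, $x\neq 0$, then, depending on the values of $x$ and $c$, the collection of generalised Lüroth expansions of $x$ produced by $L_c$ is of one of the following three types: - it consists of a unique expansion; - it consists of a finite or countable number of expansions, all of which are ultimately periodic; - it contains countably many ultimately periodic expansions and uncountably many expansions that are not ultimately periodic. Moreover, each of these three possibilities occurs for suitable $x$ and $c$.
   Context: Let $T_L:[0,1]\to[0,1]$ be given by $T_L(0)=0$, $T_L(1)=1$ and $T_L(x)=\lceil \frac1x\rceil(\lceil \frac1x\rceil-1)x-(\lceil \frac1x\rceil-1)$ for $x\ne 0,1$, and let $T_A=1-T_L$. For $c\in[0,\frac12]$ put $z_n=\frac1n$ ($n\ge1$), $z_n^+=z_n+cz_nz_{n-1}$ ($n\ge 2$), $z_n^-=z_n-cz_nz_{n+1}$ ($n\ge1$). Maps $T_{0,c},T_{1,c}:[c,1]\to[c,1]$. For $c>0$: $T_{0,c}(x)=T_A(x)$ if $x\in\bigcup_{n\ge2}[z_n,z_n^+)$ and $T_{0,c}(x)=T_L(x)$ if $x\in\{1\}\cup\bigcup_{n\ge2}[z_n^+,z_{n-1})$; $T_{1,c}(x)=T_A(x)$ if $x\in\bigcup_{n\ge2}[z_n,z_{n-1}^-]$ and $T_{1,c}(x)=T_L(x)$ if $x\in\{1\}\cup\bigcup_{n\ge2}(z_{n-1}^-,z_{n-1})$. For $c=0$: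 $T_{0,0}=T_L$ and $T_{1,0}=T_A$, except that $T_{0,0}(z_n)=T_{1,0}(z_n)=1$ for all $n\ge1$ and $T_{0,0}(0)=T_{1,0}(0)=1$. The switch region is $S=[c,1]\cap\bigcup_{n>1}[z_n^+,z_{n-1}^-]$ if $c>0$ and $S=(0,1]\setminus\{z_n:n\ge1\}$ if $c=0$. The random $c$-Lüroth transformation is $L_c:\{0,1\}^{\mathbb N}\times[c,1]\to\{0,1\}^{\mathbb N}\times[c,1]$, $L_c(\omega,x)=(\sigma(\omega),T_{\omega_1,c}(x))$, with $\sigma$ the left shift. Write $T_{\omega,c}^n=T_{\omega_n,c}\circ\cdots\circ T_{\omega_1,c}$ and $T^0_{\omega,c}=\mathrm{id}$. Signs and digits: for $x\in[c,1]$, $x\ne0$, let $s_1(\omega,x)=\omega_1$ if $x\in S$; $s_1(\omega,x)=0$ if $x=1$ or $x\in\bigcup_{n\ge1}(z_n^-,z_n)$; $s_1(\omega,x)=1$ if $x\in\bigcup_{n\ge2}[z_n,z_n^+)$; and, when $c=0$, $s_1(\omega,z_n)=1$ for $n\ge2$. Let $d_1(\omega,x)=2$ if $x=1$ and $d_1(\omega,x)=n$ if $x\in[z_n,z_{n-1})$, $n\ge2$. For $i\ge1$ put $s_i(\omega,x)=s_1(L_c^{i-1}(\omega,x))$, $d_i(\omega,x)=d_1(L_c^{i-1}(\omega,x))$. Then $$x=\sum_{n=1}^\infty(-1)^{\sum_{i=1}^{n-1}s_i}\frac{d_n-1+s_n}{\prod_{i=1}^nd_i(d_i-1)}.$$ The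 sequence $((s_i(\omega,x),d_i(\omega,x)))_{i\ge1}$ is the generalised Lüroth expansion (also called $c$-Lüroth expansion) of $x$ produced by $L_c$ along $\omega$. The expansions of $x$ produced by $L_c$ are the distinct sequences obtained as $\omega$ ranges over $\{0,1\}^{\mathbb N}$. A sequence $(a_i)_{i\ge1}$ is ultimately periodic if there are $n\ge0$, $r\ge1$ with $a_{n+j}=a_{n+r+j}$ for all $j\ge1$. *)

theory Defs
  imports Complex_Main "HOL-Library.Countable_Set"
begin

definition T_L :: "real \<Rightarrow> real" where
  "T_L x = (if x = 0 then 0 else if x = 1 then 1
     else of_int \<lceil>1 / x\<rceil> * (of_int \<lceil>1 / x\<rceil> - 1) * x - (of_int \<lceil>1 / x\<rceil> - 1))"

definition T_A :: "real \<Rightarrow> real" where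
  "T_A x = 1 - T_L x"

(* z n, zp c n and zm c n are z_n, z_n^+ and z_n^-; they are used only for n >= 1, and
   zp c n only for n >= 2. *)
definition z :: "nat \<Rightarrow> real" where
  "z n = 1 / real n"

definition zp :: "real \<Rightarrow> nat \<Rightarrow> real" where
  "zp c n = z n + c * z n * z (n - 1)"

definition zm :: "real \<Rightarrow> nat \<Rightarrow> real" where
  "zm c n = z n - c * z n * z (n + 1)"

(* For c > 0 the points of [c,1] outside the union on which T_A is used are exactly 1 and
   the points of the complementary intervals, where T_L is used:
   [z_n^+, z_(n-1)) for the map with index 0, and (z_(n-1)^-, z_(n-1)) for the map with
   index 1.  The maps matter only on [c,1]. *)
definition T0 :: "real \<Rightarrow> real \<Rightarrow> real" where
  "T0 c x =
     (if c = 0 then (if x = 0 \<or> x \<in> z ` {1..} then 1 else T_L x)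
      else if x \<in> (\<Union>n\<in>{2..}. {z n ..< zp c n}) then T_A x else T_L x)"

definition T1 :: "real \<Rightarrow> real \<Rightarrow> real" where
  "T1 c x =
     (if c = 0 then (if x = 0 \<or> x \<in> z ` {1..} then 1 else T_A x)
      else if x \<in> (\<Union>n\<in>{2..}. {z n .. zm c (n - 1)}) then T_A x else T_L x)"

definition T :: "nat \<Rightarrow> real \<Rightarrow> real \<Rightarrow> real" where
  "T j c = (if j = 0 then T0 c else T1 c)"

definition switch_region :: "real \<Rightarrow> real set" where
  "switch_region c =
     (if c = 0 then {0<..1} - z ` {1..}
      else {c..1} \<inter> (\<Union>n\<in>{2..}. {zp c n .. zm c (n - 1)}))"

(* A sequence in {0,1}^N is a function nat => nat with range in {0,1}.  All sequences are
   indexed from 0, so omega_1 is omega 0. *)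
definition binary_seqs :: "(nat \<Rightarrow> nat) set" where
  "binary_seqs = {\<omega>. range \<omega> \<subseteq> {0, 1}}"

definition L :: "real \<Rightarrow> (nat \<Rightarrow> nat) \<times> real \<Rightarrow> (nat \<Rightarrow> nat) \<times> real" where
  "L c = (\<lambda>(\<omega>, x). (\<lambda>i. \<omega> (Suc i), T (\<omega> 0) c x))"

(* First sign.  The last case consists of the points of [z_n, z_n^+), n >= 2, and, for c = 0,
   where these intervals are empty, of the points z_n, n >= 2. *)
definition s1 :: "real \<Rightarrow> (nat \<Rightarrow> nat) \<times> real \<Rightarrow> nat" where
  "s1 c = (\<lambda>(\<omega>, x).
     if x \<in> switch_region c then \<omega> 0
     else if x = 1 \<or> x \<in> (\<Union>n\<in>{1..}. {zm c n <..< z n}) then 0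
     else 1)"

(* First digit, for 0 < x <= 1. *)
definition d1 :: "(nat \<Rightarrow> nat) \<times> real \<Rightarrow> nat" where
  "d1 = (\<lambda>(\<omega>, x). if x = 1 then 2 else (THE n. n \<ge> 2 \<and> x \<in> {z n ..< z (n - 1)}))"

(* Entry i is the pair (s_(i+1), d_(i+1)). *)
definition luroth_expansion :: "real \<Rightarrow> (nat \<Rightarrow> nat) \<Rightarrow> real \<Rightarrow> nat \<Rightarrow> nat \<times> nat" where
  "luroth_expansion c \<omega> x =
     (\<lambda>i. (s1 c ((L c ^^ i) (\<omega>, x)), d1 ((L c ^^ i) (\<omega>, x))))"

definition luroth_expansions :: "real \<Rightarrow> real \<Rightarrow> (nat \<Rightarrow> nat \<times> nat) set" where
  "luroth_expansions c x = (\<lambda>\<omega>. luroth_expansion c \<omega> x) ` binary_seqs"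

definition ultimately_periodic :: "(nat \<Rightarrow> 'a) \<Rightarrow> bool" where
  "ultimately_periodic a \<longleftrightarrow> (\<exists>n r. r \<ge> 1 \<and> (\<forall>j. a (n + j) = a (n + r + j)))"

definition unique_type :: "(nat \<Rightarrow> 'a) set \<Rightarrow> bool" where
  "unique_type E \<longleftrightarrow> (\<exists>!a. a \<in> E)"

(* More than one element is required, so that the three types exclude each other and the
   occurrence of this type does not follow from that of unique_type. *)
definition periodic_type :: "(nat \<Rightarrow> 'a) set \<Rightarrow> bool" where
  "periodic_type E \<longleftrightarrow>
     countable E \<and> (\<exists>a\<in>E. \<exists>b\<in>E. a \<noteq> b) \<and> (\<forall>a\<in>E. ultimately_periodic a)"

(* "Countably many" means countably infinitely many here. *)
definition mixed_type :: "(nat \<Rightarrow> 'a) set \<Rightarrow> bool" where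
  "mixed_type E \<longleftrightarrow>
     countable {a \<in> E. ultimately_periodic a} \<and> infinite {a \<in> E. ultimately_periodic a} \<and>
     uncountable {a \<in> E. \<not> ultimately_periodic a}"

end

theory Submission
  imports Defs
begin

text \<open>
  The label \<open>(s, d)\<close> produced at a point \<open>y\<close> determines the affine map applied to \<open>y\<close>. It has integer
  coefficients and a slope of absolute value at least 2. Along a period of the expansion the orbit
  is therefore moved by one expanding affine map with integer coefficients. Being bounded, it sits
  at the rational fixed point of this map, and so the starting point is rational.

  The orbits of a rational point lie in a finite set, so its expansions are the label sequences of
  the paths in a finite graph in which a vertex has two outgoing edges exactly in the switch
  region. If a path is not ultimately periodic, it leaves some vertex in the switch region
  infinitely often along both edges. This yields two loops at that vertex with different first
  labels. Following them in arbitrary order gives uncountably many expansions, of which infinitely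
  many, but only countably many, are ultimately periodic.
\<close>

section \<open>The maps in affine coordinates\<close>

text \<open>The point 0, which lies in \<open>[c, 1]\<close> only for \<open>c = 0\<close>, is left
  out because it has no digit.\<close>

definition valid :: "real \<Rightarrow> real \<Rightarrow> bool" where
  "valid c y \<longleftrightarrow> c \<le> y \<and> 0 < y \<and> y \<le> 1"

text \<open>\<open>lin n\<close> is the increasing affine map of \<open>[z n, z (n - 1)]\<close> onto \<open>[0, 1]\<close>. It sends \<open>zp c n\<close> to \<open>c\<close>
  and \<open>zm c (n - 1)\<close> to \<open>1 - c\<close>, so that all case distinctions become conditions on \<open>lin n y\<close>.\<close>

definition lin :: "nat \<Rightarrow> real \<Rightarrow> real" where
  "lin n y = real n * (real n - 1) * y - (real n - 1)"

text \<open>As an affine map of the whole line it depends on the label alone, so equal words of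
  labels give equal compositions.\<close>

definition branch :: "nat \<times> nat \<Rightarrow> real \<Rightarrow> real" where
  "branch l y = (if fst l = 0 then lin (snd l) y else 1 - lin (snd l) y)"

text \<open>\<open>s1\<close> reads only the first entry of the sequence and \<open>d1\<close> none,
  so a constant sequence can carry the choice \<open>e\<close>.\<close>

definition label :: "real \<Rightarrow> nat \<Rightarrow> real \<Rightarrow> nat \<times> nat" where
  "label c e y = (s1 c (\<lambda>_. e, y), d1 (\<lambda>_. e, y))"

section \<open>Cells and first digits\<close>

definition in_cell :: "nat \<Rightarrow> real \<Rightarrow> bool" where
  "in_cell n y \<longleftrightarrow> n \<ge> 2 \<and> z n \<le> y \<and> y < z (n - 1)"

text \<open>The ceiling \<open>n\<close> of \<open>1 / y\<close> satisfies
  \<open>n - 1 < 1 / y \<le> n\<close>; taking reciprocals gives the cell.\<close>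

lemma in_cell_exists:
  assumes "0 < y" "y < 1"
  shows "in_cell (nat \<lceil>1 / y\<rceil>) y"
proof -
  define n where "n = nat \<lceil>1 / y\<rceil>"
  have "1 < 1 / y" using assms by simp
  then have n2: "n \<ge> 2" unfolding n_def by linarith
  have ge: "1 / y \<le> real n" and lt: "real n - 1 < 1 / y"
    unfolding n_def using \<open>1 < 1 / y\<close> by linarith+
  have "1 / real n \<le> y" using ge n2 assms by (simp add: field_simps)
  moreover have "y < 1 / real (n - 1)"
  proof -
    have "real (n - 1) = real n - 1" "real n - 1 > 0" using n2 by auto
    then show ?thesis using lt assms by (simp add: field_simps)
  qed
  ultimately show ?thesis using n2 unfolding in_cell_def z_def n_def by blast
qed

lemma in_cell_unique:
  assumes "in_cell m y" "in_cell n y"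
  shows "m = n"
proof -
  have "\<not> m < n" if "in_cell m y" "in_cell n y" for m n
  proof
    assume "m < n"
    then have "m \<le> n - 1" "0 < m" using that by (auto simp: in_cell_def)
    then have "z (n - 1) \<le> z m" unfolding z_def by (intro frac_le) auto
    then show False using that unfolding in_cell_def by linarith
  qed
  from this[OF assms] this[OF assms(2,1)] show ?thesis by simp
qed

lemma in_cell_bounds: "in_cell n y \<Longrightarrow> 0 < y \<and> y < 1"
proof -
  assume a: "in_cell n y"
  have "0 < z n" "z (n - 1) \<le> 1" using a by (auto simp: in_cell_def z_def)
  then show ?thesis using a by (auto simp: in_cell_def)
qed

lemma ceiling_in_cell: "in_cell n y \<Longrightarrow> \<lceil>1 / y\<rceil> = int n"
proof -
  assume a: "in_cell n y"
  then have "nat \<lceil>1 / y\<rceil> = n" "n \<ge> 2"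
    using in_cell_unique[OF in_cell_exists a] in_cell_bounds[OF a] by (auto simp: in_cell_def)
  then show ?thesis by linarith
qed

lemma d1_in_cell: "in_cell n y \<Longrightarrow> d1 (\<omega>, y) = n"
proof -
  assume a: "in_cell n y"
  have "(THE m. m \<ge> 2 \<and> y \<in> {z m ..< z (m - 1)}) = (THE m. in_cell m y)"
    by (simp add: in_cell_def)
  also have "\<dots> = n"
    using a in_cell_unique[OF _ a] by (rule the_equality)
  finally have "(THE m. m \<ge> 2 \<and> y \<in> {z m ..< z (m - 1)}) = n" .
  then show ?thesis using in_cell_bounds[OF a] by (simp add: d1_def)
qed

lemma T_L_in_cell: "in_cell n y \<Longrightarrow> T_L y = lin n y"
  using in_cell_bounds[of n y] ceiling_in_cell[of n y] by (simp add: T_L_def lin_def)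

text \<open>Over the common denominator \<open>N * (N - 1)\<close> the four endpoints have
  numerators \<open>N - 1 + c\<close>, \<open>N - c\<close>, \<open>N\<close> and
  \<open>N - 1\<close>, and \<open>lin n y\<close> is \<open>y\<close> times this denominator minus
  \<open>N - 1\<close>. Every comparison thus becomes linear.\<close>

lemma lin_conv:
  assumes "n \<ge> 2"
  shows "y < zp c n \<longleftrightarrow> lin n y < c"
    and "y \<le> zm c (n - 1) \<longleftrightarrow> lin n y \<le> 1 - c"
    and "y < z (n - 1) \<longleftrightarrow> lin n y < 1"
    and "z n \<le> y \<longleftrightarrow> 0 \<le> lin n y"
    and "y = z n \<longleftrightarrow> lin n y = 0"
proof -
  define N where "N = real n"
  have N: "N \<ge> 2" "real (n - 1) = N - 1" "real (n - 1 + 1) = N"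
    using assms by (auto simp: N_def of_nat_diff)
  have K: "0 < N * (N - 1)" using N by simp
  have 1: "zp c n = (N - 1 + c) / (N * (N - 1))"
  proof -
    have "zp c n = 1 / N + c * (1 / N) * (1 / (N - 1))"
      unfolding zp_def z_def N(2) N_def[symmetric] ..
    then show ?thesis using N(1) by (simp add: divide_simps)
  qed
  have 2: "zm c (n - 1) = (N - c) / (N * (N - 1))"
  proof -
    have "zm c (n - 1) = 1 / (N - 1) - c * (1 / (N - 1)) * (1 / N)"
      unfolding zm_def z_def N(2,3) ..
    then show ?thesis using N(1) by (simp add: divide_simps mult.commute)
  qed
  have 3: "z (n - 1) = N / (N * (N - 1))" "z n = (N - 1) / (N * (N - 1))"
    using N by (simp_all add: z_def N_def[symmetric])
  define P where "P = N * (N - 1)"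
  have P: "0 < P" "lin n y = y * P - (N - 1)"
    using K by (simp_all add: lin_def P_def N_def)
  have "P \<noteq> 0" using P by simp
  show "y < zp c n \<longleftrightarrow> lin n y < c" "y \<le> zm c (n - 1) \<longleftrightarrow> lin n y \<le> 1 - c"
    "y < z (n - 1) \<longleftrightarrow> lin n y < 1" "z n \<le> y \<longleftrightarrow> 0 \<le> lin n y" "y = z n \<longleftrightarrow> lin n y = 0"
    unfolding 1 2 3 P_def[symmetric] P(2) pos_less_divide_eq[OF P(1)] pos_le_divide_eq[OF P(1)]
      pos_divide_le_eq[OF P(1)] nonzero_eq_divide_eq[OF \<open>P \<noteq> 0\<close>]
    by linarith+
qed

lemma in_cell_conv: "in_cell n y \<longleftrightarrow> n \<ge> 2 \<and> 0 \<le> lin n y \<and> lin n y < 1"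
  using lin_conv(3,4)[of n y] by (auto simp: in_cell_def)

section \<open>Position of a point within its cell\<close>

context
  fixes c :: real and n :: nat and y :: real
  assumes c: "0 \<le> c" "c \<le> 1/2" and cell: "in_cell n y"
begin

text \<open>Each interval of the union lies in the cell of the same index, so disjointness of the
  cells leaves only the index \<open>n\<close>. The next lemmas follow this scheme.\<close>

lemma in_left_part: "y \<in> (\<Union>m\<in>{2..}. {z m ..< zp c m}) \<longleftrightarrow> lin n y < c"
proof -
  have "m = n" if "m \<ge> 2" "z m \<le> y" "y < zp c m" for m
  proof (rule in_cell_unique[OF _ cell])
    show "in_cell m y" using that c by (auto simp: in_cell_conv lin_conv)
  qed
  then show ?thesis using cell lin_conv[of n y] by (auto simp: in_cell_def)
qed

text \<open>For \<open>c = 0\<close> the closed right endpoint would be \<open>z (m - 1)\<close>,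
  outside cell \<open>m\<close>; positivity of \<open>c\<close> keeps the interval inside.\<close>

lemma in_T1_part:
  assumes "c > 0"
  shows "y \<in> (\<Union>m\<in>{2..}. {z m .. zm c (m - 1)}) \<longleftrightarrow> lin n y \<le> 1 - c"
proof -
  have "m = n" if "m \<ge> 2" "z m \<le> y" "y \<le> zm c (m - 1)" for m
  proof (rule in_cell_unique[OF _ cell])
    show "in_cell m y" using that c assms lin_conv(2)[of m y c] by (simp add: in_cell_conv lin_conv)
  qed
  then show ?thesis using cell lin_conv[of n y] by (auto simp: in_cell_def)
qed

lemma in_right_part: "y \<in> (\<Union>m\<in>{1..}. {zm c m <..< z m}) \<longleftrightarrow> lin n y > 1 - c"
proof -
  \<comment> \<open>The interval to the left of \<open>z m\<close> lies in the cell with digit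
    \<open>m + 1\<close>, hence the shift of the index.\<close>
  have *: "m + 1 = n" if "m \<ge> 1" "zm c m < y" "y < z m" for m
  proof (rule in_cell_unique[OF _ cell])
    show "in_cell (m + 1) y"
      using that c lin_conv(2,3)[of "m + 1" y] by (simp add: in_cell_conv not_le[symmetric])
  qed
  have "n \<ge> 2" using cell by (simp add: in_cell_def)
  show ?thesis
  proof
    assume "y \<in> (\<Union>m\<in>{1..}. {zm c m <..< z m})"
    then obtain m where m: "m \<ge> 1" "zm c m < y" "y < z m" by auto
    then have "m = n - 1" using * by fastforce
    then show "lin n y > 1 - c" using m lin_conv(2)[OF \<open>n \<ge> 2\<close>, of y c] by auto
  next
    assume "lin n y > 1 - c"
    then have "n - 1 \<ge> 1" "zm c (n - 1) < y" "y < z (n - 1)"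
      using lin_conv(2)[OF \<open>n \<ge> 2\<close>, of y c] cell by (auto simp: in_cell_def)
    then show "y \<in> (\<Union>m\<in>{1..}. {zm c m <..< z m})" by auto
  qed
qed

lemma in_z: "y \<in> z ` {1..} \<longleftrightarrow> lin n y = 0"
proof -
  have *: "m = n" if "m \<ge> 1" "y = z m" for m
  proof (rule in_cell_unique[OF _ cell])
    have "m \<noteq> 1" using that in_cell_bounds[OF cell] by (auto simp: z_def)
    then have m: "m \<ge> 2" using that by simp
    then have "lin m y = 0" using that by (simp add: lin_conv)
    then show "in_cell m y" using m by (simp add: in_cell_conv)
  qed
  have "n \<ge> 2" using cell by (simp add: in_cell_def)
  show ?thesis
  proof
    assume "y \<in> z ` {1..}"
    then obtain m where "m \<ge> 1" "y = z m" by auto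
    with * show "lin n y = 0" using lin_conv(5)[OF \<open>n \<ge> 2\<close>, of y] by blast
  next
    assume "lin n y = 0"
    then show "y \<in> z ` {1..}"
      using lin_conv(5)[OF \<open>n \<ge> 2\<close>, of y] \<open>n \<ge> 2\<close> by auto
  qed
qed

text \<open>One formula covers both cases of the definition. For \<open>c = 0\<close> the first two
  conditions hold on the whole cell and the third removes \<open>z n\<close>; for
  \<open>c > 0\<close> the third follows from the first.\<close>

lemma in_switch:
  assumes "c \<le> y"
  shows "y \<in> switch_region c \<longleftrightarrow> c \<le> lin n y \<and> lin n y \<le> 1 - c \<and> 0 < lin n y"
proof (cases "c = 0")
  case True
  have "0 < y" "y < 1" using in_cell_bounds[OF cell] by auto
  then show ?thesis using True in_z cell by (auto simp: switch_region_def in_cell_conv)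
next
  case False
  have *: "m = n" if "m \<ge> 2" "zp c m \<le> y" "y \<le> zm c (m - 1)" for m
  proof (rule in_cell_unique[OF _ cell])
    show "in_cell m y"
      using that c False lin_conv(1,2)[of m y c]
      by (simp add: in_cell_conv not_less[symmetric])
  qed
  have "n \<ge> 2" "y < 1" using cell in_cell_bounds[OF cell] by (auto simp: in_cell_def)
  show ?thesis
  proof
    assume "y \<in> switch_region c"
    then obtain m where "m \<ge> 2" "zp c m \<le> y" "y \<le> zm c (m - 1)"
      using False by (auto simp: switch_region_def)
    moreover from this have "m = n" by (rule *)
    ultimately have "\<not> y < zp c n" "y \<le> zm c (n - 1)" by auto
    then show "c \<le> lin n y \<and> lin n y \<le> 1 - c \<and> 0 < lin n y"
      unfolding lin_conv(1,2)[OF \<open>n \<ge> 2\<close>, of y c] using False c by linarith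
  next
    assume "c \<le> lin n y \<and> lin n y \<le> 1 - c \<and> 0 < lin n y"
    then have "y \<in> {zp c n .. zm c (n - 1)}"
      using lin_conv(1,2)[OF \<open>n \<ge> 2\<close>, of y c] by auto
    then show "y \<in> switch_region c"
      using \<open>n \<ge> 2\<close> \<open>y < 1\<close> False assms by (auto simp: switch_region_def)
  qed
qed

end

section \<open>The point 1, which lies in no cell\<close>

lemma one_in_z: "1 \<in> z ` {1..}"
  by (force simp: z_def image_def)

lemma not_in_cell_one: "\<not> in_cell n 1"
  using in_cell_bounds by force

lemma one_notin_switch:
  assumes "0 \<le> c" "c \<le> 1/2"
  shows "1 \<notin> switch_region c"
proof (cases "c = 0")
  case True
  then show ?thesis using one_in_z by (auto simp: switch_region_def)
next
  case False
  have "zm c (m - 1) < 1" if "m \<ge> 2" for m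
  proof -
    have "0 < c * z (m - 1) * z (m - 1 + 1)" "z (m - 1) \<le> 1"
      using that False assms by (auto simp: z_def)
    then show ?thesis by (auto simp: zm_def)
  qed
  then show ?thesis using False by (force simp: switch_region_def)
qed

lemma T_one:
  assumes "0 \<le> c" "c \<le> 1/2"
  shows "T e c 1 = 1"
proof -
  have "1 \<notin> (\<Union>n\<in>{2..}. {z n ..< zp c n})"
  proof
    assume "1 \<in> (\<Union>n\<in>{2..}. {z n ..< zp c n})"
    then obtain m where "m \<ge> 2" "z m \<le> 1" "1 < zp c m" by auto
    then have "in_cell m 1" using assms by (auto simp: in_cell_conv lin_conv)
    then show False by (simp add: not_in_cell_one)
  qed
  then have "T0 c 1 = 1" using one_in_z by (simp only: T0_def if_False) (simp add: T_L_def)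
  moreover have "T1 c 1 = 1"
  proof (cases "c = 0")
    case True
    then show ?thesis using one_in_z by (simp add: T1_def)
  next
    case False
    have "1 \<notin> (\<Union>n\<in>{2..}. {z n .. zm c (n - 1)})"
    proof
      assume "1 \<in> (\<Union>n\<in>{2..}. {z n .. zm c (n - 1)})"
      then obtain m where "m \<ge> 2" "z m \<le> 1" "1 \<le> zm c (m - 1)" by auto
      then have "in_cell m 1"
        using assms False lin_conv(2)[of m 1 c] by (simp add: in_cell_conv lin_conv)
      then show False by (simp add: not_in_cell_one)
    qed
    then show ?thesis using False by (simp only: T1_def if_False) (simp add: T_L_def)
  qed
  ultimately show ?thesis by (simp add: T_def)
qed

text \<open>The increasing branch \<open>lin 2\<close> fixes 1, so with the digit 2 prescribed there
  \<open>branch\<close> describes the maps at 1 too.\<close>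

lemma label_one: "0 \<le> c \<Longrightarrow> c \<le> 1/2 \<Longrightarrow> label c e 1 = (0, 2)"
  using one_notin_switch[of c] by (simp add: label_def s1_def d1_def)

lemma label_in_cell:
  assumes "0 \<le> c" "c \<le> 1/2" "c \<le> y" "in_cell n y"
  shows "label c e y =
    (if c \<le> lin n y \<and> lin n y \<le> 1 - c \<and> 0 < lin n y then e
     else if lin n y > 1 - c then 0 else 1, n)"
  using assms in_cell_bounds[OF assms(4)] in_switch[of c n y] in_right_part[of c n y]
  by (simp add: label_def s1_def d1_in_cell)

text \<open>Off the switch region the two maps agree, since \<open>c \<le> 1 - c\<close>: both use
  \<open>T_A\<close> where \<open>lin n y < c\<close> and \<open>T_L\<close> where
  \<open>lin n y > 1 - c\<close>. For \<open>c = 0\<close> the exceptional value 1 at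
  \<open>z n\<close> is \<open>1 - lin n y\<close>, in accordance with the sign 1.\<close>

lemma T_in_cell:
  assumes "0 \<le> c" "c \<le> 1/2" "c \<le> y" "in_cell n y" "e \<in> {0, 1}"
  shows "T e c y = branch (label c e y) y"
proof -
  have w: "0 \<le> lin n y" "lin n y < 1" using assms by (auto simp: in_cell_conv)
  have y: "0 < y" using in_cell_bounds[OF assms(4)] by simp
  note b = in_left_part[OF assms(1,2,4)] in_T1_part[OF assms(1,2,4)] in_z[OF assms(1,2,4)]
  have "T0 c y = (if c = 0 then (if lin n y = 0 then 1 else lin n y)
      else if lin n y < c then 1 - lin n y else lin n y)"
    unfolding T0_def T_A_def T_L_in_cell[OF assms(4)] b(1,3) using y by simp
  moreover have "T1 c y = (if c = 0 then 1 - lin n y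
      else if lin n y \<le> 1 - c then 1 - lin n y else lin n y)"
  proof (cases "c = 0")
    case True
    then show ?thesis
      unfolding T1_def T_A_def T_L_in_cell[OF assms(4)] b(3) using y by simp
  next
    case False
    then have "c > 0" using assms by simp
    then show ?thesis
      unfolding T1_def T_A_def T_L_in_cell[OF assms(4)] b(2)[OF \<open>c > 0\<close>] by simp
  qed
  moreover have "branch (s, n) y = (if s = 0 then lin n y else 1 - lin n y)" for s
    by (simp add: branch_def)
  ultimately show ?thesis
    unfolding label_in_cell[OF assms(1-4)] T_def using w assms(1,2,5) by auto
qed

text \<open>Inside a cell, sign 0 occurs only where \<open>lin n y\<close> is positive and at least
  \<open>c\<close>, and sign 1 only where it is at most \<open>1 - c\<close> and below 1. Either way
  the image is a valid point.\<close>

lemma T_step: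
  assumes c: "0 \<le> c" "c \<le> 1/2" and v: "valid c y" and e: "e \<in> {0, 1}"
  shows "T e c y = branch (label c e y) y" "valid c (T e c y)" "snd (label c e y) \<ge> 2"
proof -
  have "T e c y = branch (label c e y) y \<and> valid c (T e c y) \<and> snd (label c e y) \<ge> 2"
  proof (cases "y = 1")
    case True
    then show ?thesis using c by (simp add: T_one label_one branch_def lin_def valid_def)
  next
    case False
    then obtain n where n: "in_cell n y"
      using in_cell_exists v by (force simp: valid_def)
    then have *: "T e c y = branch (label c e y) y"
      using c v e T_in_cell by (auto simp: valid_def)
    have "c \<le> y" using v by (simp add: valid_def)
    then show ?thesis
      using * c n label_in_cell[OF c \<open>c \<le> y\<close> n, of e]
      by (auto simp: in_cell_conv valid_def branch_def)
  qed
  then show "T e c y = branch (label c e y) y" "valid c (T e c y)" "snd (label c e y) \<ge> 2"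
    by auto
qed

lemma fst_label_switch: "y \<in> switch_region c \<Longrightarrow> fst (label c e y) = e"
  by (simp add: label_def s1_def)

lemma label_notin_switch: "y \<notin> switch_region c \<Longrightarrow> label c e y = label c e' y"
  by (simp add: label_def s1_def d1_def)

section \<open>Ultimately periodic sequences\<close>

text \<open>Cantor's diagonal argument.\<close>

lemma uncountable_nat_bool: "uncountable (UNIV :: (nat \<Rightarrow> bool) set)"
proof
  assume "countable (UNIV :: (nat \<Rightarrow> bool) set)"
  then obtain f :: "nat \<Rightarrow> nat \<Rightarrow> bool" where f: "range f = UNIV"
    by (metis UNIV_not_empty uncountable_def)
  then obtain k where "(\<lambda>n. \<not> f n n) = f k" by (metis UNIV_I imageE)
  then have "(\<not> f k k) = f k k" by metis
  then show False by simp
qed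

lemma ultimately_periodic_shift:
  assumes "ultimately_periodic (\<lambda>i. a (N + i))"
  shows "ultimately_periodic a"
proof -
  from assms obtain n r where r: "r \<ge> 1" "\<And>j. a (N + (n + j)) = a (N + (n + r + j))"
    unfolding ultimately_periodic_def by blast
  have "a (N + n + j) = a (N + n + r + j)" for j
    using r(2)[of j] by (simp add: add.assoc)
  then show ?thesis unfolding ultimately_periodic_def using r(1) by blast
qed

text \<open>A preperiod \<open>n\<close>, a period \<open>r\<close> and the first
  \<open>n + r\<close> entries determine the sequence; \<open>F\<close> rebuilds it from these
  data.\<close>

lemma countable_ultimately_periodic:
  "countable {a :: nat \<Rightarrow> 'a :: countable. ultimately_periodic a}"
proof -
  define F :: "nat \<times> nat \<times> 'a list \<Rightarrow> nat \<Rightarrow> 'a"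
    where "F = (\<lambda>(n, r, xs) i. if i < n then xs ! i else xs ! (n + (i - n) mod r))"
  have "a \<in> range F" if "ultimately_periodic a" for a
  proof -
    from that obtain n r where r: "r \<ge> 1" "\<And>j. a (n + j) = a (n + r + j)"
      unfolding ultimately_periodic_def by blast
    have mult: "a (n + (j + k * r)) = a (n + j)" for j k
    proof (induction k)
      case (Suc k)
      have "a (n + (j + Suc k * r)) = a (n + r + (j + k * r))" by (simp add: algebra_simps)
      also have "\<dots> = a (n + (j + k * r))" using r(2) by simp
      finally show ?case using Suc by simp
    qed simp
    have "a i = F (n, r, map a [0..<n + r]) i" for i
    proof (cases "i < n")
      case False
      have lt: "(i - n) mod r < r" using r(1) by simp
      have "a i = a (n + ((i - n) mod r + (i - n) div r * r))" using False by simp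
      also have "\<dots> = a (n + (i - n) mod r)" by (rule mult)
      finally show ?thesis using False lt by (simp add: F_def del: upt_Suc)
    qed (simp add: F_def)
    then show ?thesis by blast
  qed
  then have "{a. ultimately_periodic a} \<subseteq> range F" by blast
  then show ?thesis by (rule countable_subset) simp
qed

text \<open>By the pigeonhole principle \<open>y\<close> takes some value twice, and from there on
  the recursion by \<open>g\<close> repeats itself.\<close>

lemma ultimately_periodic_deterministic:
  assumes "finite V" "\<And>i. y i \<in> V" "\<And>i. a i = h (y i)" "\<And>i. y (Suc i) = g (y i)"
  shows "ultimately_periodic (a :: nat \<Rightarrow> 'a)"
proof -
  have "\<not> inj y"
    using assms(1,2) finite_subset[of "range y" V] finite_imageD infinite_UNIV_nat by blast
  then obtain i j where "i \<noteq> j" "y i = y j" by (auto simp: inj_def)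
  then obtain i j where ij: "i < j" "y i = y j" by (metis linorder_neqE_nat)
  have "y (i + k) = y (j + k)" for k
    by (induction k) (use ij assms(4) in auto)
  then have "a (i + k) = a (i + (j - i) + k)" for k
    using assms(3) ij by simp
  moreover have "j - i \<ge> 1" using ij by simp
  ultimately show ?thesis unfolding ultimately_periodic_def by blast
qed

section \<open>Orbits and expansions\<close>

fun orbit :: "real \<Rightarrow> (nat \<Rightarrow> nat) \<Rightarrow> real \<Rightarrow> nat \<Rightarrow> real" where
  "orbit c \<omega> x 0 = x"
| "orbit c \<omega> x (Suc n) = T (\<omega> n) c (orbit c \<omega> x n)"

lemma funpow_L: "(L c ^^ n) (\<omega>, x) = (\<lambda>i. \<omega> (n + i), orbit c \<omega> x n)"
  by (induction n) (simp_all add: L_def)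

lemma expansion_label: "luroth_expansion c \<omega> x n = label c (\<omega> n) (orbit c \<omega> x n)"
  by (simp add: luroth_expansion_def funpow_L label_def s1_def d1_def)

lemma orbit_add: "orbit c \<omega> x (n + k) = orbit c (\<lambda>i. \<omega> (n + i)) (orbit c \<omega> x n) k"
  by (induction k) simp_all

lemma orbit_cong: "(\<And>i. i < n \<Longrightarrow> \<omega> i = \<omega>' i) \<Longrightarrow> orbit c \<omega> x n = orbit c \<omega>' x n"
  by (induction n) simp_all

lemma binary_seqs_iff: "\<omega> \<in> binary_seqs \<longleftrightarrow> (\<forall>i. \<omega> i \<in> {0, 1})"
  by (simp only: binary_seqs_def mem_Collect_eq image_subset_iff) simp

lemma branch_affine:
  assumes "snd l \<ge> 2"
  obtains A B :: int where "\<bar>A\<bar> \<ge> 2" "\<And>y. branch l y = of_int A * y + of_int B"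
proof -
  define d where "d = int (snd l)"
  have d: "d \<ge> 2" "real (snd l) = of_int d" using assms by (auto simp: d_def)
  have "2 * 1 \<le> d * (d - 1)" using d by (intro mult_mono) auto
  then have ge: "2 \<le> d * (d - 1)" by simp
  show ?thesis
  proof (cases "fst l = 0")
    case True
    show ?thesis
      by (rule that[of "d * (d - 1)" "1 - d"])
        (use ge True d(2) in \<open>simp_all add: branch_def lin_def algebra_simps\<close>)
  next
    case False
    show ?thesis
      by (rule that[of "- (d * (d - 1))" "d"])
        (use ge False d(2) in \<open>simp_all add: branch_def lin_def algebra_simps\<close>)
  qed
qed

section \<open>Periodic expansions and rational points\<close>

context
  fixes c :: real
  assumes c: "0 \<le> c" "c \<le> 1/2"
begin

lemma orbit_valid:
  assumes "\<omega> \<in> binary_seqs" "valid c x"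
  shows "valid c (orbit c \<omega> x n)"
  by (induction n) (use assms c T_step(2) in \<open>auto simp: binary_seqs_iff\<close>)

lemma orbit_step:
  assumes "\<omega> \<in> binary_seqs" "valid c x"
  shows "orbit c \<omega> x (Suc n) = branch (luroth_expansion c \<omega> x n) (orbit c \<omega> x n)"
  using T_step(1)[OF c orbit_valid[OF assms]] assms(1)
  by (simp add: expansion_label binary_seqs_iff)

lemma digit_ge_2:
  assumes "\<omega> \<in> binary_seqs" "valid c x"
  shows "snd (luroth_expansion c \<omega> x n) \<ge> 2"
  using T_step(3)[OF c orbit_valid[OF assms]] assms(1)
  by (simp add: expansion_label binary_seqs_iff)

lemma periodic_imp_rational:
  assumes "\<omega> \<in> binary_seqs" "valid c x" "ultimately_periodic (luroth_expansion c \<omega> x)"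
  shows "x \<in> \<rat>"
proof -
  define y where "y = orbit c \<omega> x"
  define a where "a = luroth_expansion c \<omega> x"
  have y_step: "y (Suc i) = branch (a i) (y i)" for i
    using orbit_step[OF assms(1,2)] by (simp add: y_def a_def)
  have y_bd: "0 < y i" "y i \<le> 1" for i
    using orbit_valid[OF assms(1,2)] by (auto simp: y_def valid_def)
  have dig: "snd (a i) \<ge> 2" for i
    using digit_ge_2[OF assms(1,2)] by (simp add: a_def)
  obtain n r where r: "r \<ge> 1" and per: "\<And>j. a (n + j) = a (n + r + j)"
    using assms(3) unfolding ultimately_periodic_def a_def by blast
  \<comment> \<open>Quantifying over all \<open>u\<close> makes \<open>A\<close> and
    \<open>B\<close> depend only on the labels, so one map serves every repetition of the
    period.\<close>
  have aff: "\<exists>A B :: int. \<bar>A\<bar> \<ge> 2 ^ m \<and>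
      (\<forall>u. (\<forall>i<m. u (Suc i) = branch (a (n + i)) (u i)) \<longrightarrow> u m = of_int A * u 0 + of_int B)" for m
  proof (induction m)
    case 0
    show ?case by (rule exI[of _ 1], rule exI[of _ 0]) simp
  next
    case (Suc m)
    then obtain A B :: int where AB: "\<bar>A\<bar> \<ge> 2 ^ m"
      "\<And>u. (\<forall>i<m. u (Suc i) = branch (a (n + i)) (u i)) \<Longrightarrow> u m = of_int A * u 0 + of_int B"
      by blast
    obtain A' B' :: int where A': "\<bar>A'\<bar> \<ge> 2" "\<And>y. branch (a (n + m)) y = of_int A' * y + of_int B'"
      using branch_affine[OF dig] by blast
    have "2 * 2 ^ m \<le> \<bar>A'\<bar> * \<bar>A\<bar>" using AB(1) A'(1) by (intro mult_mono) auto
    then have "\<bar>A' * A\<bar> \<ge> 2 ^ Suc m" by (simp add: abs_mult)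
    moreover have "u (Suc m) = of_int (A' * A) * u 0 + of_int (A' * B + B')"
      if "\<forall>i<Suc m. u (Suc i) = branch (a (n + i)) (u i)" for u
    proof -
      have "u (Suc m) = of_int A' * u m + of_int B'" using that A'(2) by simp
      moreover have "u m = of_int A * u 0 + of_int B" using AB(2) that by simp
      ultimately show ?thesis by (simp add: algebra_simps)
    qed
    ultimately show ?case by blast
  qed
  obtain A B :: int where AB: "\<bar>A\<bar> \<ge> 2 ^ r"
    "\<And>u. (\<forall>i<r. u (Suc i) = branch (a (n + i)) (u i)) \<Longrightarrow> u r = of_int A * u 0 + of_int B"
    using aff[of r] by blast
  have a_mult: "a (n + k * r + i) = a (n + i)" for k i
  proof (induction k)
    case (Suc k)
    have "a (n + Suc k * r + i) = a (n + r + (k * r + i))" by (simp add: algebra_simps)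
    also have "\<dots> = a (n + (k * r + i))" using per by simp
    finally show ?case using Suc by (simp add: add.assoc)
  qed simp
  have y_r: "y (n + Suc k * r) = of_int A * y (n + k * r) + of_int B" for k
    using AB(2)[of "\<lambda>i. y (n + k * r + i)"] y_step a_mult by (simp add: algebra_simps)
  have "(2::int) \<le> 2 ^ r" using r self_le_power[of "2::int" r] by simp
  then have A2: "\<bar>A\<bar> \<ge> 2" using AB(1) by linarith
  \<comment> \<open>The fixed point of the map that moves the orbit by one period.\<close>
  define p :: real where "p = of_int B / of_int (1 - A)"
  have "A \<noteq> 1" using A2 by auto
  then have p: "p = of_int A * p + of_int B" by (simp add: p_def field_simps)
  have dev: "y (n + k * r) - p = of_int A ^ k * (y n - p)" for k
  proof (induction k)
    case (Suc k)
    have "y (n + Suc k * r) - p = of_int A * (y (n + k * r) - p)"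
      using p y_r[of k] by (simp add: algebra_simps)
    then show ?case using Suc by simp
  qed simp
  have "y n = p"
  proof (rule ccontr)
    assume "y n \<noteq> p"
    then have e: "\<bar>y n - p\<bar> > 0" by simp
    \<comment> \<open>Orbit points lie in \<open>(0, 1]\<close>, so their distance from
      \<open>p\<close> is at most \<open>1 + \<bar>p\<bar>\<close>. After this many periods the
      initial deviation would have grown beyond that.\<close>
    obtain k where k: "(1 + \<bar>p\<bar>) / \<bar>y n - p\<bar> < 2 ^ k"
      using real_arch_pow[of 2] by auto
    have "(2::real) ^ k \<le> \<bar>of_int A\<bar> ^ k"
      using A2 by (intro power_mono) (auto simp flip: of_int_abs)
    then have "(1 + \<bar>p\<bar>) / \<bar>y n - p\<bar> < \<bar>of_int A\<bar> ^ k" using k by simp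
    then have "1 + \<bar>p\<bar> < \<bar>of_int A\<bar> ^ k * \<bar>y n - p\<bar>"
      using e by (simp add: pos_divide_less_eq)
    also have "\<dots> = \<bar>y (n + k * r) - p\<bar>" by (simp add: dev abs_mult power_abs)
    finally show False using y_bd[of "n + k * r"] by linarith
  qed
  then have "y n \<in> \<rat>" by (simp add: p_def)
  \<comment> \<open>Inverting the branches carries rationality back to the starting point.\<close>
  have "y n \<in> \<rat> \<Longrightarrow> y 0 \<in> \<rat>" for n
  proof (induction n)
    case (Suc n)
    obtain A B :: int where A: "\<bar>A\<bar> \<ge> 2" "\<And>y. branch (a n) y = of_int A * y + of_int B"
      using branch_affine[OF dig] by blast
    then have "y n = (y (Suc n) - of_int B) / of_int A"
      using y_step[of n] by (auto simp: field_simps)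
    then show ?case using Suc by simp
  qed simp
  then show ?thesis using \<open>y n \<in> \<rat>\<close> by (simp add: y_def)
qed

text \<open>The orbits of a rational number stay among the fractions with its denominator.\<close>

lemma rational_orbit_finite:
  assumes "valid c x" "x \<in> \<rat>"
  obtains V where "finite V" "\<And>\<omega> i. \<omega> \<in> binary_seqs \<Longrightarrow> orbit c \<omega> x i \<in> V"
proof -
  obtain p q :: int where q: "q > 0" and x: "x = of_int p / of_int q"
    using assms(2) by (auto elim: Rats_cases')
  define V where "V = (\<lambda>k::int. real_of_int k / of_int q) ` {0..q}"
  have frac: "\<exists>k::int. orbit c \<omega> x i = of_int k / of_int q" if "\<omega> \<in> binary_seqs" for \<omega> i
  proof (induction i)
    case (Suc i)
    then obtain k :: int where k: "orbit c \<omega> x i = of_int k / of_int q" by blast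
    obtain A B :: int where
      "\<And>y. branch (luroth_expansion c \<omega> x i) y = of_int A * y + of_int B"
      using branch_affine[OF digit_ge_2[OF \<open>\<omega> \<in> binary_seqs\<close> assms(1)]] by blast
    then have "orbit c \<omega> x (Suc i) = of_int (A * k + B * q) / of_int q"
      using orbit_step[OF \<open>\<omega> \<in> binary_seqs\<close> assms(1)] k q by (simp add: field_simps)
    then show ?case by blast
  qed (use x in auto)
  have "orbit c \<omega> x i \<in> V" if "\<omega> \<in> binary_seqs" for \<omega> i
  proof -
    obtain k :: int where k: "orbit c \<omega> x i = of_int k / of_int q"
      using frac[OF \<open>\<omega> \<in> binary_seqs\<close>] by blast
    moreover have "0 < orbit c \<omega> x i" "orbit c \<omega> x i \<le> 1"
      using orbit_valid[OF that assms(1)] by (auto simp: valid_def)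
    ultimately have "0 \<le> k" "k \<le> q" using q by (auto simp: zero_less_divide_iff)
    then show ?thesis using k by (auto simp: V_def)
  qed
  moreover have "finite V" by (simp add: V_def)
  ultimately show ?thesis using that by blast
qed

text \<open>Without such a point \<open>v\<close> each of the finitely many orbit points eventually determines the
  label, so the orbit becomes deterministic.\<close>

lemma not_periodic_imp_branching:
  assumes \<omega>: "\<omega> \<in> binary_seqs" and x: "valid c x" "x \<in> \<rat>"
    and np: "\<not> ultimately_periodic (luroth_expansion c \<omega> x)"
  obtains v where "v \<in> switch_region c"
    "\<exists>\<^sub>\<infinity>i. orbit c \<omega> x i = v \<and> \<omega> i = 0" "\<exists>\<^sub>\<infinity>i. orbit c \<omega> x i = v \<and> \<omega> i = 1"
proof (rule ccontr)
  assume no: "\<not> thesis"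
  define y where "y = orbit c \<omega> x"
  obtain V where V: "finite V" "\<And>i. y i \<in> V"
    using \<omega> by (auto simp: y_def intro: rational_orbit_finite[OF x])
  have "\<exists>l. \<forall>\<^sub>\<infinity>i. y i = v \<longrightarrow> luroth_expansion c \<omega> x i = l" for v
  proof (cases "v \<in> switch_region c")
    case False
    have "\<forall>\<^sub>\<infinity>i. y i = v \<longrightarrow> luroth_expansion c \<omega> x i = label c 0 v"
      using label_notin_switch[OF False] by (intro always_eventually) (auto simp: expansion_label y_def)
    then show ?thesis by blast
  next
    case True
    then have "(\<forall>\<^sub>\<infinity>i. \<not> (y i = v \<and> \<omega> i = 0)) \<or> (\<forall>\<^sub>\<infinity>i. \<not> (y i = v \<and> \<omega> i = 1))"
      using no that[of v] unfolding y_def frequently_def by argo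
    then obtain e :: nat where e: "e \<in> {0, 1}" "\<forall>\<^sub>\<infinity>i. \<not> (y i = v \<and> \<omega> i = e)"
      by blast
    \<comment> \<open>The choice \<open>e\<close> is made at \<open>v\<close> only finitely often,
      so eventually every visit uses the other one, \<open>1 - e\<close>.\<close>
    have "\<forall>\<^sub>\<infinity>i. y i = v \<longrightarrow> luroth_expansion c \<omega> x i = label c (1 - e) v"
      using e(2)
    proof (rule eventually_mono)
      fix i assume "\<not> (y i = v \<and> \<omega> i = e)"
      moreover have "\<omega> i \<in> {0, 1}" using \<omega> by (simp add: binary_seqs_iff)
      ultimately show "y i = v \<longrightarrow> luroth_expansion c \<omega> x i = label c (1 - e) v"
        using e(1) by (auto simp: expansion_label y_def)
    qed
    then show ?thesis by blast
  qed
  then obtain l where l: "\<And>v. \<forall>\<^sub>\<infinity>i. y i = v \<longrightarrow> luroth_expansion c \<omega> x i = l v" by metis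
  \<comment> \<open>Finiteness of \<open>V\<close> merges the separate bounds for each
    \<open>v\<close> into a single one.\<close>
  have "\<forall>\<^sub>\<infinity>i. \<forall>v\<in>V. y i = v \<longrightarrow> luroth_expansion c \<omega> x i = l v"
    using V(1) l by (intro eventually_ball_finite) auto
  then obtain N where N: "\<And>i. i \<ge> N \<Longrightarrow> luroth_expansion c \<omega> x i = l (y i)"
    using V(2) by (auto simp: MOST_nat_le)
  have "ultimately_periodic (\<lambda>i. luroth_expansion c \<omega> x (N + i))"
  proof (rule ultimately_periodic_deterministic[where y = "\<lambda>i. y (N + i)" and V = V
        and h = l and g = "\<lambda>v. branch (l v) v"])
    show "luroth_expansion c \<omega> x (N + i) = l (y (N + i))" for i using N by simp
    show "y (N + Suc i) = branch (l (y (N + i))) (y (N + i))" for i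
      using orbit_step[OF \<omega> x(1), of "N + i"] N[of "N + i"] by (simp add: y_def)
  qed (use V in auto)
  then show False using np ultimately_periodic_shift[of "luroth_expansion c \<omega> x"] by blast
qed

text \<open>The two loops at \<open>v\<close>, of lengths \<open>p\<close> and \<open>q\<close> and with first signs 0 and 1, are run through one
  after the other in both orders. This gives two loops of the same length \<open>m\<close>, which can be
  concatenated freely.\<close>

lemma branching_imp_mixed_type:
  assumes \<omega>: "\<omega> \<in> binary_seqs" and x: "valid c x" and v: "v \<in> switch_region c"
    and U: "i1 < j1" "orbit c \<omega> x i1 = v" "orbit c \<omega> x j1 = v" "\<omega> i1 = 0"
    and W: "i2 < j2" "orbit c \<omega> x i2 = v" "orbit c \<omega> x j2 = v" "\<omega> i2 = 1"
  shows "mixed_type (luroth_expansions c x)"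
proof -
  define p q m where "p = j1 - i1" and "q = j2 - i2" and "m = p + q"
  have pq: "p > 0" "q > 0" "m > 0" "j1 = i1 + p" "j2 = i2 + q"
    using U W by (auto simp: p_def q_def m_def)
  \<comment> \<open>\<open>w True\<close> starts with the loop of length \<open>q\<close>, hence
    with sign 1; \<open>w False\<close> starts with the loop of length \<open>p\<close>, hence with
    sign 0.\<close>
  define w where "w b r =
      (if b then if r < q then \<omega> (i2 + r) else \<omega> (i1 + (r - q))
       else if r < p then \<omega> (i1 + r) else \<omega> (i2 + (r - p)))" for b :: bool and r
  have loopU: "orbit c (\<lambda>i. \<omega> (i1 + i)) v p = v"
    using orbit_add[of c \<omega> x i1 p] U pq by simp
  have loopW: "orbit c (\<lambda>i. \<omega> (i2 + i)) v q = v"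
    using orbit_add[of c \<omega> x i2 q] W pq by simp
  have loop: "orbit c (w b) v m = v" for b
  proof (cases b)
    case True
    have 1: "orbit c (w b) v q = v"
      using loopW orbit_cong[of q "w b" "\<lambda>i. \<omega> (i2 + i)" c v] True by (simp add: w_def)
    have "orbit c (w b) v (q + p) = orbit c (\<lambda>i. w b (q + i)) v p"
      using 1 by (simp add: orbit_add)
    also have "\<dots> = orbit c (\<lambda>i. \<omega> (i1 + i)) v p"
      by (rule orbit_cong) (simp add: w_def True)
    finally show ?thesis using loopU by (simp add: m_def add.commute)
  next
    case False
    have 1: "orbit c (w b) v p = v"
      using loopU orbit_cong[of p "w b" "\<lambda>i. \<omega> (i1 + i)" c v] False by (simp add: w_def)
    have "orbit c (w b) v (p + q) = orbit c (\<lambda>i. w b (p + i)) v q"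
      using 1 by (simp add: orbit_add)
    also have "\<dots> = orbit c (\<lambda>i. \<omega> (i2 + i)) v q"
      by (rule orbit_cong) (simp add: w_def False)
    finally show ?thesis using loopW by (simp add: m_def)
  qed
  \<comment> \<open>The first \<open>i1\<close> choices lead from \<open>x\<close> to
    \<open>v\<close>; afterwards block \<open>k\<close>, of length \<open>m\<close>, follows
    \<open>w (b k)\<close>.\<close>
  define \<psi> where "\<psi> b i = (if i < i1 then \<omega> i else w (b ((i - i1) div m)) ((i - i1) mod m))"
    for b :: "nat \<Rightarrow> bool" and i
  have \<psi>_block: "\<psi> b (i1 + k * m + r) = w (b k) r" if "r < m" for b k r
  proof -
    have "(k * m + r) div m = k" "(k * m + r) mod m = r" using that by auto
    then show ?thesis by (simp add: \<psi>_def add.assoc)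
  qed
  have \<psi>_bin: "\<psi> b \<in> binary_seqs" for b
    using \<omega> by (auto simp: binary_seqs_iff \<psi>_def w_def)
  have at_v: "orbit c (\<psi> b) x (i1 + k * m) = v" for b k
  proof (induction k)
    case 0
    have "orbit c (\<psi> b) x i1 = orbit c \<omega> x i1"
      by (rule orbit_cong) (simp add: \<psi>_def)
    then show ?case using U(2) by simp
  next
    case (Suc k)
    have "orbit c (\<psi> b) x (i1 + k * m + m) = orbit c (\<lambda>i. \<psi> b (i1 + k * m + i)) v m"
      using Suc by (simp add: orbit_add)
    also have "\<dots> = orbit c (w (b k)) v m"
      by (rule orbit_cong) (simp add: \<psi>_block)
    finally show ?case using loop by (simp add: algebra_simps)
  qed
  define E where "E b = luroth_expansion c (\<psi> b) x" for b
  have E_in: "E b \<in> luroth_expansions c x" for b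
    using \<psi>_bin by (auto simp: E_def luroth_expansions_def)
  \<comment> \<open>Because \<open>v\<close> is in the switch region, the sign at the start of block
    \<open>k\<close> reveals \<open>b k\<close>; this makes \<open>E\<close> injective.\<close>
  have sign: "fst (E b (i1 + k * m)) = (if b k then 1 else 0)" for b k
  proof -
    have "\<psi> b (i1 + k * m) = (if b k then 1 else 0)"
      using \<psi>_block[of 0 b k] pq U(4) W(4) by (simp add: w_def)
    then show ?thesis
      using at_v[of b k] fst_label_switch[OF v] by (simp add: E_def expansion_label)
  qed
  have injE: "inj E"
  proof (rule injI)
    fix a b assume "E a = E b"
    then have "(if a k then 1 else 0 :: nat) = (if b k then 1 else 0)" for k
      using sign by metis
    then have "a k = b k" for k by (metis zero_neq_one)
    then show "a = b" by blast
  qed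
  \<comment> \<open>With a single \<open>True\<close> at \<open>k\<close>, only
    \<open>w False\<close> is repeated after block \<open>k\<close>. Varying \<open>k\<close> yields
    infinitely many periodic expansions.\<close>
  have up: "ultimately_periodic (E (\<lambda>i. i = k))" for k
  proof -
    define b where "b = (\<lambda>i. i = k)"
    define n where "n = i1 + Suc k * m"
    have tail: "\<psi> b (n + i) = w False (i mod m)" for i
    proof -
      have "\<psi> b (i1 + (Suc k + i div m) * m + i mod m) = w False (i mod m)"
        using \<psi>_block[of "i mod m" b "Suc k + i div m"] pq by (simp add: b_def)
      moreover have "i1 + (Suc k + i div m) * m + i mod m = n + i"
        by (simp add: n_def algebra_simps)
      ultimately show ?thesis by simp
    qed
    have v1: "orbit c (\<psi> b) x n = v" unfolding n_def by (rule at_v)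
    have v2: "orbit c (\<psi> b) x (n + m) = v"
      using at_v[of b "Suc (Suc k)"] by (simp add: n_def algebra_simps)
    have "E b (n + j) = E b (n + m + j)" for j
    proof -
      have "(\<lambda>i. \<psi> b (n + m + i)) = (\<lambda>i. \<psi> b (n + i))"
        using tail by (simp add: add.assoc)
      then have "orbit c (\<psi> b) x (n + m + j) = orbit c (\<psi> b) x (n + j)"
        unfolding orbit_add[of c _ x "n + m" j] orbit_add[of c _ x n j] v1 v2 by simp
      moreover have "\<psi> b (n + m + j) = \<psi> b (n + j)"
        using tail by (simp add: add.assoc)
      ultimately show ?thesis by (simp add: E_def expansion_label)
    qed
    then show ?thesis
      unfolding ultimately_periodic_def b_def[symmetric] using pq by (metis One_nat_def Suc_leI)
  qed
  have P: "countable {a \<in> luroth_expansions c x. ultimately_periodic a}"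
    by (rule countable_subset[OF _ countable_ultimately_periodic]) auto
  moreover have "infinite {a \<in> luroth_expansions c x. ultimately_periodic a}"
  proof -
    have "inj (\<lambda>k::nat. E (\<lambda>i. i = k))"
      using injE by (auto simp: inj_def fun_eq_iff)
    then have "infinite (range (\<lambda>k::nat. E (\<lambda>i. i = k)))"
      by (rule range_inj_infinite)
    moreover have "range (\<lambda>k::nat. E (\<lambda>i. i = k)) \<subseteq> {a \<in> luroth_expansions c x. ultimately_periodic a}"
      using E_in up by auto
    ultimately show ?thesis using finite_subset by blast
  qed
  \<comment> \<open>If these were countable, adding the countably many periodic expansions would
    make the range of the injective \<open>E\<close> countable.\<close>
  moreover have "uncountable {a \<in> luroth_expansions c x. \<not> ultimately_periodic a}"
  proof
    assume "countable {a \<in> luroth_expansions c x. \<not> ultimately_periodic a}"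
    then have "countable ({a \<in> luroth_expansions c x. \<not> ultimately_periodic a} \<union>
        {a \<in> luroth_expansions c x. ultimately_periodic a})"
      using P by (rule countable_Un)
    then have "countable (range E)"
      by (rule countable_subset[rotated]) (use E_in in auto)
    then show False
      using injE countable_image_inj_on uncountable_nat_bool by blast
  qed
  ultimately show ?thesis by (simp add: mixed_type_def)
qed

lemma rational_trichotomy:
  assumes x: "valid c x" "x \<in> \<rat>"
  shows "unique_type (luroth_expansions c x) \<or> periodic_type (luroth_expansions c x) \<or>
    mixed_type (luroth_expansions c x)"
proof (cases "\<forall>a\<in>luroth_expansions c x. ultimately_periodic a")
  case True
  have "countable (luroth_expansions c x)"
    by (rule countable_subset[OF _ countable_ultimately_periodic]) (use True in auto)
  moreover have "luroth_expansions c x \<noteq> {}"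
    by (auto simp: luroth_expansions_def binary_seqs_def)
  ultimately show ?thesis
    using True unfolding unique_type_def periodic_type_def by blast
next
  case False
  then obtain \<omega> where \<omega>: "\<omega> \<in> binary_seqs"
    and np: "\<not> ultimately_periodic (luroth_expansion c \<omega> x)"
    by (auto simp: luroth_expansions_def)
  obtain v where v: "v \<in> switch_region c"
    "\<exists>\<^sub>\<infinity>i. orbit c \<omega> x i = v \<and> \<omega> i = 0" "\<exists>\<^sub>\<infinity>i. orbit c \<omega> x i = v \<and> \<omega> i = 1"
    using not_periodic_imp_branching[OF \<omega> x np] by blast
  \<comment> \<open>The loop with first sign 0 runs from \<open>i1\<close> to \<open>i2\<close>, the
    one with first sign 1 from \<open>i2\<close> to \<open>j2\<close>; \<open>i2\<close> is thus an
    endpoint of both.\<close>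
  obtain i1 where i1: "orbit c \<omega> x i1 = v" "\<omega> i1 = 0"
    using v(2) by (auto simp: INFM_nat)
  obtain i2 where i2: "i1 < i2" "orbit c \<omega> x i2 = v" "\<omega> i2 = 1"
    using v(3) by (auto simp: INFM_nat)
  obtain j2 where j2: "i2 < j2" "orbit c \<omega> x j2 = v"
    using v(3) by (auto simp: INFM_nat)
  show ?thesis
    using branching_imp_mixed_type[OF \<omega> x(1) v(1) i2(1) i1(1) i2(2) i1(2) j2(1) i2(2) j2(2) i2(3)]
    by blast
qed

end

section \<open>Examples for the three types\<close>

lemma label_0:
  assumes "in_cell n y"
  shows "label 0 e y = (if lin n y = 0 then 1 else e, n)"
  using label_in_cell[of 0 y n e] assms in_cell_bounds[OF assms] by (auto simp: in_cell_conv)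

lemma T_0:
  assumes "in_cell n y" "e \<in> {0, 1}"
  shows "T e 0 y = (if lin n y = 0 \<or> e = 1 then 1 - lin n y else lin n y)"
  using T_in_cell[of 0 y n e] assms in_cell_bounds[OF assms(1)]
  by (auto simp: label_0 branch_def)

lemma unique_type_example: "unique_type (luroth_expansions 0 1)"
proof -
  have "orbit 0 \<omega> 1 n = 1" for \<omega> n by (induction n) (simp_all add: T_one)
  then have "luroth_expansion 0 \<omega> 1 = (\<lambda>_. (0, 2))" for \<omega>
    by (simp add: fun_eq_iff expansion_label label_one)
  moreover have "binary_seqs \<noteq> {}" by (auto simp: binary_seqs_def)
  ultimately have "luroth_expansions 0 1 = {\<lambda>_. (0, 2)}"
    by (auto simp: luroth_expansions_def)
  then show ?thesis by (simp add: unique_type_def)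
qed

text \<open>Every orbit is 3/4, 1/2, 1, 1, ..., and only the first sign is free.\<close>

lemma periodic_type_example: "periodic_type (luroth_expansions 0 (3/4))"
proof -
  have c34: "in_cell 2 (3/4)" "lin 2 (3/4) = 1/2" and c12: "in_cell 2 (1/2)" "lin 2 (1/2) = 0"
    by (simp_all add: in_cell_conv lin_def)
  have up: "ultimately_periodic (luroth_expansion 0 \<omega> (3/4))" if "\<omega> \<in> binary_seqs" for \<omega>
  proof -
    have e: "\<omega> i \<in> {0, 1}" for i using that by (simp add: binary_seqs_iff)
    have y1: "orbit 0 \<omega> (3/4) (Suc 0) = 1/2"
      using T_0[OF c34(1) e] c34(2) by simp
    have y2: "orbit 0 \<omega> (3/4) (Suc (Suc 0)) = 1"
      unfolding orbit.simps(2)[of _ _ _ "Suc 0"] y1 using T_0[OF c12(1) e] c12(2) by simp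
    have one: "orbit 0 \<omega> (3/4) (2 + k) = 1" for k
    proof (induction k)
      case 0
      show ?case using y2 by (simp only: numeral_2_eq_2 add_0_right)
    qed (simp add: T_one)
    have tail: "luroth_expansion 0 \<omega> (3/4) (2 + k) = (0, 2)" for k
      unfolding expansion_label one by (simp add: label_one)
    have "luroth_expansion 0 \<omega> (3/4) (2 + k) = luroth_expansion 0 \<omega> (3/4) (2 + 1 + k)" for k
      unfolding add.assoc tail ..
    then show ?thesis unfolding ultimately_periodic_def by (metis order_refl)
  qed
  then have all: "\<forall>a\<in>luroth_expansions 0 (3/4). ultimately_periodic a"
    by (auto simp: luroth_expansions_def)
  have "luroth_expansion 0 (\<lambda>_. 0) (3/4) 0 \<noteq> luroth_expansion 0 (\<lambda>_. 1) (3/4) 0"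
    using c34 by (simp add: expansion_label label_0)
  then have "luroth_expansion 0 (\<lambda>_. 0) (3/4) \<noteq> luroth_expansion 0 (\<lambda>_. 1) (3/4)" by metis
  moreover have "luroth_expansion 0 (\<lambda>_. e) (3/4) \<in> luroth_expansions 0 (3/4)" if "e \<in> {0, 1}" for e
    using that by (auto simp: luroth_expansions_def binary_seqs_def)
  ultimately have "\<exists>a\<in>luroth_expansions 0 (3/4). \<exists>b\<in>luroth_expansions 0 (3/4). a \<noteq> b" by blast
  moreover have "countable (luroth_expansions 0 (3/4))"
    by (rule countable_subset[OF _ countable_ultimately_periodic]) (use all in auto)
  ultimately show ?thesis using all by (simp add: periodic_type_def)
qed

text \<open>The point 2/5 is fixed under sign 0, while signs 1, 1, 1 lead through 3/5 and 4/5 back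
  to it. These are the two loops at a point of the switch region.\<close>

lemma mixed_type_example: "mixed_type (luroth_expansions 0 (2/5))"
proof -
  have c25: "in_cell 3 (2/5)" "lin 3 (2/5) = 2/5"
    and c35: "in_cell 2 (3/5)" "lin 2 (3/5) = 1/5"
    and c45: "in_cell 2 (4/5)" "lin 2 (4/5) = 3/5"
    by (simp_all add: in_cell_conv lin_def)
  define \<omega> :: "nat \<Rightarrow> nat" where "\<omega> i = (if i = 0 then 0 else 1)" for i
  have y1: "orbit 0 \<omega> (2/5) (Suc 0) = 2/5"
    using T_0[OF c25(1), of 0] c25(2) by (simp add: \<omega>_def)
  have y2: "orbit 0 \<omega> (2/5) (Suc (Suc 0)) = 3/5"
    unfolding orbit.simps(2)[of _ _ _ "Suc 0"] y1
    using T_0[OF c25(1), of 1] c25(2) by (simp add: \<omega>_def)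
  have y3: "orbit 0 \<omega> (2/5) (Suc (Suc (Suc 0))) = 4/5"
    unfolding orbit.simps(2)[of _ _ _ "Suc (Suc 0)"] y2
    using T_0[OF c35(1), of 1] c35(2) by (simp add: \<omega>_def)
  have y4: "orbit 0 \<omega> (2/5) (Suc (Suc (Suc (Suc 0)))) = 2/5"
    unfolding orbit.simps(2)[of _ _ _ "Suc (Suc (Suc 0))"] y3
    using T_0[OF c45(1), of 1] c45(2) by (simp add: \<omega>_def)
  show ?thesis
  proof (rule branching_imp_mixed_type[of 0 \<omega> "2/5" "2/5" 0 "Suc 0" "Suc 0" "Suc (Suc (Suc (Suc 0)))"])
    show "2/5 \<in> switch_region (0::real)"
      using in_switch[OF _ _ c25(1), of 0] c25(2) by simp
  qed (use y1 y4 in \<open>auto simp: valid_def binary_seqs_iff \<omega>_def\<close>)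
qed

theorem theorem1:
  "(\<forall>c\<in>{0..1/2 :: real}.
      (\<forall>x\<in>{c..1} - \<rat>. \<forall>a\<in>luroth_expansions c x. \<not> ultimately_periodic a) \<and>
      (\<forall>x\<in>{c..1} \<inter> \<rat>. x \<noteq> 0 \<longrightarrow>
         unique_type (luroth_expansions c x) \<or>
         periodic_type (luroth_expansions c x) \<or>
         mixed_type (luroth_expansions c x))) \<and>
   (\<exists>c\<in>{0..1/2 :: real}. \<exists>x\<in>{c..1} \<inter> \<rat>. x \<noteq> 0 \<and> unique_type (luroth_expansions c x)) \<and>
   (\<exists>c\<in>{0..1/2 :: real}. \<exists>x\<in>{c..1} \<inter> \<rat>. x \<noteq> 0 \<and> periodic_type (luroth_expansions c x)) \<and>
   (\<exists>c\<in>{0..1/2 :: real}. \<exists>x\<in>{c..1} \<inter> \<rat>. x \<noteq> 0 \<and> mixed_type (luroth_expansions c x))"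
proof (intro conjI ballI impI)
  fix c :: real and x a
  assume c: "c \<in> {0..1/2}" and x: "x \<in> {c..1} - \<rat>" and a: "a \<in> luroth_expansions c x"
  have "x \<noteq> 0" using x by auto
  then have "valid c x" using c x by (auto simp: valid_def)
  then show "\<not> ultimately_periodic a"
    using periodic_imp_rational[of c _ x] c x a by (auto simp: luroth_expansions_def)
next
  fix c x :: real
  assume "c \<in> {0..1/2}" "x \<in> {c..1} \<inter> \<rat>" "x \<noteq> 0"
  then show "unique_type (luroth_expansions c x) \<or> periodic_type (luroth_expansions c x) \<or>
      mixed_type (luroth_expansions c x)"
    by (intro rational_trichotomy) (auto simp: valid_def)
next
  show "\<exists>c\<in>{0..1/2 :: real}. \<exists>x\<in>{c..1} \<inter> \<rat>. x \<noteq> 0 \<and> unique_type (luroth_expansions c x)"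
    using unique_type_example by (intro bexI[of _ 0] bexI[of _ 1]) auto
  show "\<exists>c\<in>{0..1/2 :: real}. \<exists>x\<in>{c..1} \<inter> \<rat>. x \<noteq> 0 \<and> periodic_type (luroth_expansions c x)"
    using periodic_type_example by (intro bexI[of _ 0] bexI[of _ "3/4"]) auto
  show "\<exists>c\<in>{0..1/2 :: real}. \<exists>x\<in>{c..1} \<inter> \<rat>. x \<noteq> 0 \<and> mixed_type (luroth_expansions c x)"
    using mixed_type_example by (intro bexI[of _ 0] bexI[of _ "2/5"]) auto
qed

end
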